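(* Let $\Psi:[0,\infty)\to[0,\infty)$ be a bounded function. Then $\Psi$ is completely monotone (on $[0,\infty)$) if and only if the two following conditions hold: (a) the function $\Psi$ has a holomorphic extension on $\{z\in\mathbb{C}:\mathrm{Re}(z)>0\}$ and remains bounded there; (b) the sequence $(\Psi(k))_{k\geq 0}$ is completely monotone and minimal.
   Context: All functions are measurable. A function $\Psi:[0,\infty)\to[0,\infty)$ is completely monotone on $[0,\infty)$ if it is continuous on $[0,\infty)$, infinitely differentiable on $(0,\infty)$, and $(-1)^n\Psi^{(n)}\geq 0$ on $(0,\infty)$ for every integer $n\ge 0$; equivalently, $\Psi(\lambda)=\int_{[0,\infty)}e^{-\lambda x}\,\nu(dx)$, $\lambda\ge 0$, for a finite positive measure $\nu$ on $[0,\infty)$. For a sequence $a=(a_k)_{k\ge 0}$ put $\Delta a(k)=a_{k+1}-a_k$ and let $\Delta^n$ be the iterates of $\Delta$. A non-negative sequence $a$ is completely monotone if $(-1)^n\Delta^n a(k)\ge 0$ for all integers $n,k\geq 0$. A completely monotone sequence $a$ is minimal if for every $\epsilon>0$ the sequence $(a_0-\epsilon,a_1,a_2,\dots)$ is not completely monotone. "$\Psi$ has a holomorphic extension on $\mathrm{Re}(z)>0$" means that there is a holomorphic function on $\{\mathrm{Re}(z)>0\}$ coinciding with $\Psi$ on $(0,\infty)$. *)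

theory Defs
  imports "HOL-Complex_Analysis.Complex_Analysis"
begin

(* A function on [0,oo) is represented by a total function on the reals, of which only the
   values on [0,oo) matter: the iterated derivatives at a point x > 0 depend only on the
   values near x. *)
definition completely_monotone :: "(real \<Rightarrow> real) \<Rightarrow> bool" where
  "completely_monotone \<Psi> \<longleftrightarrow>
     (\<forall>x\<ge>0. \<Psi> x \<ge> 0) \<and>
     continuous_on {0..} \<Psi> \<and>
     (\<forall>n. \<forall>x>0. (deriv ^^ n) \<Psi> differentiable (at x)) \<and>
     (\<forall>n. \<forall>x>0. (- 1) ^ n * (deriv ^^ n) \<Psi> x \<ge> 0)"

definition fwd_diff :: "(nat \<Rightarrow> real) \<Rightarrow> nat \<Rightarrow> real" where
  "fwd_diff a k = a (k + 1) - a k"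

definition completely_monotone_seq :: "(nat \<Rightarrow> real) \<Rightarrow> bool" where
  "completely_monotone_seq a \<longleftrightarrow>
     (\<forall>k. a k \<ge> 0) \<and> (\<forall>n k. (- 1) ^ n * (fwd_diff ^^ n) a k \<ge> 0)"

definition minimal_seq :: "(nat \<Rightarrow> real) \<Rightarrow> bool" where
  "minimal_seq a \<longleftrightarrow> (\<forall>\<epsilon>>0. \<not> completely_monotone_seq (a(0 := a 0 - \<epsilon>)))"

end

theory Submission imports Defs begin

text \<open>
  Two facts carry the proof.

  Uniqueness (\<open>bounded_halfplane_eqI\<close>): a bounded holomorphic function on the right
  half-plane is determined by its values at the positive integers. Each zero of such a
  function can be divided out by a Blaschke factor without increasing the bound, and the
  product of the factors with zeros \<open>1, 2, 3, \<dots>\<close> diverges to \<open>0\<close>.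

  Existence (\<open>completely_monotone_seq_interpolation\<close>): every completely monotone sequence
  \<open>a\<close> is interpolated at the positive integers by a holomorphic function \<open>g\<close> on the right
  half-plane that is bounded by \<open>a 0\<close> and whose derivatives on the positive axis have
  alternating signs. It is a limit of exponential sums built from Hausdorff's discrete
  approximations to the moment problem, found by Montel's theorem; the representing measure
  itself never appears.

  Suppose that \<open>\<Psi>\<close> is completely monotone. Iterated differences of \<open>\<Psi>\<close> with any step have
  the signs of its derivatives, so \<open>\<Psi> (k / m)\<close> is a completely monotone sequence in \<open>k\<close> for
  each \<open>m\<close>. By uniqueness the interpolating functions for different \<open>m\<close> are rescalings of a
  single one, which therefore agrees with \<open>\<Psi>\<close> at all positive rationals and is the bounded
  extension. If the sequence were not minimal, uniqueness would bound \<open>\<Psi>\<close> on the positive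
  axis strictly below \<open>\<Psi> 0\<close>, against continuity at \<open>0\<close>.

  Conversely, the given bounded extension must be the interpolating function \<open>g\<close> of the
  sequence, so the derivatives of \<open>\<Psi>\<close> on the positive axis have the right signs. Minimality
  says that \<open>\<Psi> 0\<close> does not exceed the limit of \<open>\<Psi>\<close> at \<open>0\<close> from the right, so \<open>\<Psi>\<close> is
  continuous there.
\<close>

section \<open>Bounded holomorphic functions vanishing at the positive integers\<close>

text \<open>
  The map \<open>z \<mapsto> (z - a) / (z + a)\<close> carries the half-plane onto the unit disc and
  \<open>a\<close> to \<open>0\<close>, so this is the Schwarz lemma in another coordinate. That the quotient keeps
  the same bound \<open>M\<close>, with no loss, is what allows the division to be repeated.
\<close>

lemma halfplane_divide_Blaschke_factor:
  fixes H :: "complex \<Rightarrow> complex" and a :: real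
  assumes hol: "H holomorphic_on {z. Re z > 0}"
    and bnd: "\<And>z. Re z > 0 \<Longrightarrow> norm (H z) \<le> M"
    and a: "a > 0" and zero: "H (of_real a) = 0"
  obtains K where "K holomorphic_on {z. Re z > 0}"
    and "\<And>z. Re z > 0 \<Longrightarrow> norm (K z) \<le> M"
    and "\<And>z. Re z > 0 \<Longrightarrow> H z = (z - of_real a) / (z + of_real a) * K z"
proof -
  define \<psi> :: "complex \<Rightarrow> complex" where "\<psi> = (\<lambda>w. of_real a * (1 + w) / (1 - w))"
  define \<phi> :: "complex \<Rightarrow> complex" where "\<phi> = (\<lambda>z. (z - of_real a) / (z + of_real a))"
  have psi: "Re (\<psi> w) > 0" if "norm w < 1" for w
  proof -
    have "w \<noteq> 1" using that by auto
    have "\<psi> w = of_real a * ((1 + w) / (1 - w))" by (simp add: \<psi>_def)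
    also have "(1 + w) / (1 - w) = (1 + w) * cnj (1 - w) / of_real ((norm (1 - w))\<^sup>2)"
      using complex_div_cnj[of "1 + w" "1 - w"] by (simp only: of_real_power)
    finally have "Re (\<psi> w) = a * (Re ((1 + w) * cnj (1 - w)) / (norm (1 - w))\<^sup>2)"
      by (simp only: Re_divide_of_real Re_complex_of_real Im_complex_of_real times_complex.sel(1)
          mult_zero_left diff_zero)
    also have "Re ((1 + w) * cnj (1 - w)) = 1 - (norm w)\<^sup>2"
      unfolding cmod_power2 by (simp add: algebra_simps power2_eq_square)
    finally have "Re (\<psi> w) = a * ((1 - (norm w)\<^sup>2) / (norm (1 - w))\<^sup>2)" .
    moreover have "1 - (norm w)\<^sup>2 > 0"
      using that by (simp add: abs_square_less_1)
    ultimately show ?thesis using a \<open>w \<noteq> 1\<close> by simp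
  qed
  have phi: "norm (\<phi> z) < 1" and psi_phi: "\<psi> (\<phi> z) = z" if "Re z > 0" for z
  proof -
    have nz: "z + of_real a \<noteq> 0" using that a by (auto simp: complex_eq_iff)
    have "(norm (z - of_real a))\<^sup>2 < (norm (z + of_real a))\<^sup>2"
      unfolding cmod_power2 using that a by (simp add: power2_eq_square algebra_simps)
    then have "norm (z - of_real a) < norm (z + of_real a)"
      using power_less_imp_less_base norm_ge_zero by blast
    then show "norm (\<phi> z) < 1" using nz by (simp add: \<phi>_def norm_divide)
    have "1 - \<phi> z = 2 * of_real a / (z + of_real a)" "1 + \<phi> z = 2 * z / (z + of_real a)"
      using nz by (simp_all add: \<phi>_def field_simps)
    then show "\<psi> (\<phi> z) = z" using nz a by (simp add: \<psi>_def)
  qed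
  define g where "g = H \<circ> \<psi>"
  have holg: "g holomorphic_on ball 0 1"
    unfolding g_def
  proof (rule holomorphic_on_compose_gen[OF _ hol])
    show "\<psi> holomorphic_on ball 0 1"
      unfolding \<psi>_def by (intro holomorphic_intros) auto
    show "\<psi> ` ball 0 1 \<subseteq> {z. 0 < Re z}" using psi by auto
  qed
  have g0: "g 0 = 0" using zero by (simp add: g_def \<psi>_def)
  obtain h where holh: "h holomorphic_on ball 0 1"
    and gh: "\<And>w. norm w < 1 \<Longrightarrow> g w = w * h w" and h0: "deriv g 0 = h 0"
    using Schwarz3[OF holg g0] by metis
  have M0: "M \<ge> 0" by (rule order_trans[OF norm_ge_zero bnd[of 1]]) simp
  have hM: "norm (h w) \<le> M" if w: "norm w < 1" for w
  proof (rule field_le_epsilon)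
    \<comment> \<open>The Schwarz lemma wants a strict bound, so it is applied with \<open>M + e\<close>; the value
      \<open>h 0\<close> is the derivative of \<open>g\<close> at \<open>0\<close> and is covered by its second part.\<close>
    fix e :: real assume "e > 0"
    define M' where "M' = M + e"
    have M': "M' > 0" using M0 \<open>e > 0\<close> by (simp add: M'_def)
    define f where "f = (\<lambda>w. g w / of_real M')"
    have f: "f holomorphic_on ball 0 1" unfolding f_def
      using holg M' by (intro holomorphic_intros) auto
    have f0: "f 0 = 0" by (simp add: f_def g0)
    have f1: "norm (f u) < 1" if "norm u < 1" for u
    proof -
      have "norm (f u) = norm (H (\<psi> u)) / M'"
        using M' by (simp add: f_def g_def norm_divide)
      moreover have "M < M'" using \<open>e > 0\<close> by (simp add: M'_def)
      ultimately show ?thesis using bnd[OF psi[OF that]] M' by simp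
    qed
    show "norm (h w) \<le> M + e"
    proof (cases "w = 0")
      case True
      have "g field_differentiable at 0"
        using holg by (auto intro: holomorphic_on_imp_differentiable_at)
      then have "deriv f 0 = deriv g 0 / of_real M'"
        unfolding f_def by (rule deriv_cdivide_right)
      then have "norm (h w) / M' \<le> 1"
        using Schwarz_Lemma(2)[OF f f0 f1 w] True h0 M' by (simp add: norm_divide)
      then show ?thesis using M' by (simp add: M'_def)
    next
      case False
      have "norm (f w) \<le> norm w" by (rule Schwarz_Lemma(1)[OF f f0 f1 w])
      then have "norm w * norm (h w) \<le> norm w * M'"
        using M' by (simp add: f_def gh[OF w] norm_divide norm_mult field_simps)
      then show ?thesis using False by (simp add: M'_def)
    qed
  qed
  show thesis
  proof
    show "(h \<circ> \<phi>) holomorphic_on {z. Re z > 0}"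
    proof (rule holomorphic_on_compose_gen[OF _ holh])
      have "z + of_real a \<noteq> 0" if "Re z > 0" for z
        using that a by (auto simp: complex_eq_iff)
      then show "\<phi> holomorphic_on {z. Re z > 0}"
        unfolding \<phi>_def by (intro holomorphic_intros) auto
      show "\<phi> ` {z. 0 < Re z} \<subseteq> ball 0 1" using phi by auto
    qed
    show "norm ((h \<circ> \<phi>) z) \<le> M" if "Re z > 0" for z
      using hM[OF phi[OF that]] by simp
    show "H z = (z - of_real a) / (z + of_real a) * (h \<circ> \<phi>) z" if "Re z > 0" for z
      using gh[OF phi[OF that]] psi_phi[OF that] by (simp add: g_def \<phi>_def)
  qed
qed

lemma bounded_halfplane_Blaschke_bound:
  fixes H :: "complex \<Rightarrow> complex"
  assumes hol: "H holomorphic_on {z. Re z > 0}"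
    and bnd: "\<And>z. Re z > 0 \<Longrightarrow> norm (H z) \<le> M"
    and zeros: "\<And>k::nat. k \<in> {1..n} \<Longrightarrow> H (of_nat k) = 0"
    and z: "Re z > 0"
  shows "norm (H z) \<le> M * (\<Prod>k=1..n. norm ((z - of_nat k) / (z + of_nat k)))"
proof -
  have "\<exists>K. K holomorphic_on {z. Re z > 0} \<and> (\<forall>z. Re z > 0 \<longrightarrow> norm (K z) \<le> M) \<and>
          (\<forall>z. Re z > 0 \<longrightarrow> H z = (\<Prod>k=1..n. (z - of_nat k) / (z + of_nat k)) * K z)"
    using zeros
  proof (induction n)
    case 0
    show ?case using hol bnd by (intro exI[of _ H]) auto
  next
    case (Suc n)
    have "\<And>k::nat. k \<in> {1..n} \<Longrightarrow> H (of_nat k) = 0" using Suc.prems by auto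
    from Suc.IH[OF this] obtain K where K: "K holomorphic_on {z. Re z > 0}"
      "\<And>z. Re z > 0 \<Longrightarrow> norm (K z) \<le> M"
      "\<And>z. Re z > 0 \<Longrightarrow> H z = (\<Prod>k=1..n. (z - of_nat k) / (z + of_nat k)) * K z"
      by blast
    have "(\<Prod>k=1..n. (of_nat (Suc n) - of_nat k) / (of_nat (Suc n) + of_nat k) :: complex) \<noteq> 0"
    proof -
      have "(of_nat (Suc n) - of_nat k) / (of_nat (Suc n) + of_nat k) \<noteq> (0 :: complex)"
        if "k \<in> {1..n}" for k
      proof -
        have "of_nat (Suc n) - of_nat k \<noteq> (0 :: complex)"
          using that by (simp del: of_nat_Suc)
        moreover have "of_nat (Suc n) + of_nat k \<noteq> (0 :: complex)"
          using of_nat_eq_0_iff[of "Suc n + k", where 'a = complex] by (simp del: of_nat_eq_0_iff add: add.assoc)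
        ultimately show ?thesis by simp
      qed
      then show ?thesis by (simp del: of_nat_Suc)
    qed
    then have "K (of_real (real (Suc n))) = 0"
      using K(3)[of "of_nat (Suc n)"] Suc.prems[of "Suc n"] by (auto simp del: of_nat_Suc)
    then obtain L where L: "L holomorphic_on {z. Re z > 0}"
      "\<And>z. Re z > 0 \<Longrightarrow> norm (L z) \<le> M"
      "\<And>z. Re z > 0 \<Longrightarrow> K z = (z - of_real (real (Suc n))) / (z + of_real (real (Suc n))) * L z"
      using halfplane_divide_Blaschke_factor[OF K(1,2), of "real (Suc n)"] by auto
    show ?case
      using L K(3) by (intro exI[of _ L]) (auto simp del: of_nat_Suc simp: mult.assoc)
  qed
  then obtain K where K: "\<And>z. Re z > 0 \<Longrightarrow> norm (K z) \<le> M"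
    "\<And>z. Re z > 0 \<Longrightarrow> H z = (\<Prod>k=1..n. (z - of_nat k) / (z + of_nat k)) * K z" by blast
  show ?thesis
    using mult_right_mono[OF K(1)[OF z], of "\<Prod>k=1..n. norm ((z - of_nat k) / (z + of_nat k))"]
    by (simp add: K(2)[OF z] norm_mult prod_norm mult.commute prod_nonneg)
qed

text \<open>
  A special case of the Blaschke condition: the zeros \<open>1, 2, 3, \<dots>\<close> approach the boundary
  point at infinity so slowly that the product of the Blaschke factors diverges to \<open>0\<close>. It
  is enough to see this on an interval of the real axis. For \<open>1/2 \<le> x < 1\<close> each factor is
  at most its value at \<open>1/2\<close>, and at \<open>1/2\<close> the product telescopes to \<open>1 / (2 n + 1)\<close>.
\<close>

lemma bounded_halfplane_zero_at_naturals:
  fixes H :: "complex \<Rightarrow> complex"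
  assumes hol: "H holomorphic_on {z. Re z > 0}"
    and bnd: "\<And>z. Re z > 0 \<Longrightarrow> norm (H z) \<le> M"
    and zeros: "\<And>k::nat. k > 0 \<Longrightarrow> H (of_nat k) = 0"
    and z: "Re z > 0"
  shows "H z = 0"
proof -
  have M0: "M \<ge> 0" by (rule order_trans[OF norm_ge_zero bnd[of 1]]) simp
  have real_zero: "H (of_real x) = 0" if x: "1/2 \<le> x" "x < 1" for x :: real
  proof -
    have "norm (H (of_real x)) \<le> M * (1 / (2 * real n + 1))" for n
    proof -
      have "norm (H (of_real x)) \<le> M * (\<Prod>k=1..n. norm ((of_real x - of_nat k) / (of_real x + of_nat k :: complex)))"
        using zeros x by (intro bounded_halfplane_Blaschke_bound[OF hol bnd]) auto
      also have "(\<Prod>k=1..n. norm ((of_real x - of_nat k) / (of_real x + of_nat k :: complex)))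
                  \<le> (\<Prod>k=1..n. (2 * real k - 1) / (2 * real k + 1))"
      proof (rule prod_mono, intro conjI)
        fix k assume k: "k \<in> {1..n}"
        have "norm ((of_real x - of_nat k) / (of_real x + of_nat k :: complex)) = \<bar>x - real k\<bar> / \<bar>x + real k\<bar>"
          using norm_of_real[of "x - real k", where 'a = complex] norm_of_real[of "x + real k", where 'a = complex]
          by (simp add: norm_divide)
        also have "\<dots> = (real k - x) / (x + real k)" using k x by simp
        also have "\<dots> \<le> (2 * real k - 1) / (2 * real k + 1)"
        proof -
          have "0 \<le> real k * (4 * x - 2)" using x by simp
          then show ?thesis using x k by (simp add: divide_simps algebra_simps)
        qed
        finally show "norm ((of_real x - of_nat k) / (of_real x + of_nat k :: complex)) \<le> (2 * real k - 1) / (2 * real k + 1)" .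
      qed simp
      also have "(\<Prod>k=1..n. (2 * real k - 1) / (2 * real k + 1)) = 1 / (2 * real n + 1)"
        by (induction n) (simp_all add: field_simps)
      finally show ?thesis using M0 by (simp add: mult_left_mono)
    qed
    moreover have "(\<lambda>n. M * (1 / (2 * real n + 1))) \<longlonglongrightarrow> 0" by real_asymp
    ultimately have "norm (H (of_real x)) \<le> 0"
      by (intro Lim_bounded2[of _ 0 0]) auto
    then show ?thesis by simp
  qed
  show ?thesis
  proof (rule analytic_continuation[OF hol, of "of_real ` {1/2..<1}" "of_real (1/2)"])
    show "open {z. Re z > 0}" by (simp add: open_halfspace_Re_gt)
    show "connected {z. Re z > 0}"
      by (intro convex_connected convex_halfspace_Re_gt)
    have "(1/2::real) islimpt {1/2..<1}" by simp
    then show "complex_of_real (1/2) islimpt of_real ` {1/2..<1}"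
      by (rule islimpt_isCont_image)
        (simp_all only: of_real_eq_iff eventually_neq_at_within isCont_of_real continuous_ident)
  qed (use z real_zero in auto)
qed

section \<open>Discrete measures with prescribed moments\<close>

definition alt_diff :: "(nat \<Rightarrow> real) \<Rightarrow> nat \<Rightarrow> nat \<Rightarrow> real" where
  "alt_diff a n k = (- 1) ^ n * (fwd_diff ^^ n) a k"

lemma alt_diff_0 [simp]: "alt_diff a 0 k = a k"
  by (simp add: alt_diff_def)

lemma alt_diff_Suc: "alt_diff a (Suc n) k = alt_diff a n k - alt_diff a n (Suc k)"
  by (simp add: alt_diff_def fwd_diff_def algebra_simps)

lemma completely_monotone_seq_iff_alt_diff:
  "completely_monotone_seq a \<longleftrightarrow> (\<forall>n k. alt_diff a n k \<ge> 0)"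
proof -
  have "a k \<ge> 0" if "\<forall>n k. alt_diff a n k \<ge> 0" for k
    using that[rule_format, of 0 k] by simp
  then show ?thesis by (auto simp: completely_monotone_seq_def alt_diff_def)
qed

text \<open>
  Reading the recursion of the differences backwards, \<open>alt_diff a i j\<close> is the sum of
  \<open>alt_diff a (Suc i) j\<close> and \<open>alt_diff a i (Suc j)\<close>; unfolding it \<open>m\<close> times gives binomial
  coefficients, as in Pascal's triangle.
\<close>

lemma sum_choose_alt_diff:
  "(\<Sum>k\<le>m. real (m choose k) * alt_diff a (i + (m - k)) (k + j)) = alt_diff a i j"
proof (induction m arbitrary: i j)
  case (Suc m)
  have "(\<Sum>k\<le>Suc m. real (Suc m choose k) * alt_diff a (i + (Suc m - k)) (k + j))
      = alt_diff a (i + Suc m) j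
        + (\<Sum>k\<le>m. real (m choose Suc k) * alt_diff a (i + (m - k)) (Suc k + j))
        + (\<Sum>k\<le>m. real (m choose k) * alt_diff a (i + (m - k)) (k + Suc j))"
    by (subst sum.atMost_Suc_shift) (simp add: algebra_simps sum.distrib)
  also have "alt_diff a (i + Suc m) j
        + (\<Sum>k\<le>m. real (m choose Suc k) * alt_diff a (i + (m - k)) (Suc k + j))
      = (\<Sum>k\<le>Suc m. real (m choose k) * alt_diff a (i + (Suc m - k)) (k + j))"
    by (subst sum.atMost_Suc_shift) simp
  also have "\<dots> = (\<Sum>k\<le>m. real (m choose k) * alt_diff a (Suc i + (m - k)) (k + j))"
    by (simp add: Suc_diff_le)
  also have "\<dots> + (\<Sum>k\<le>m. real (m choose k) * alt_diff a (i + (m - k)) (k + Suc j))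
      = alt_diff a (Suc i) j + alt_diff a i (Suc j)"
    by (simp only: Suc.IH)
  finally show ?case by (simp add: alt_diff_Suc)
qed simp

text \<open>
  The mass that Hausdorff's solution of the moment problem puts at the node \<open>k / N\<close>. If
  \<open>a\<close> is the moment sequence of a measure on the unit interval, it is the integral of the
  \<open>k\<close>-th Bernstein polynomial of degree \<open>N\<close>.
\<close>

definition hausdorff_weight :: "(nat \<Rightarrow> real) \<Rightarrow> nat \<Rightarrow> nat \<Rightarrow> real" where
  "hausdorff_weight a N k = real (N choose k) * alt_diff a (N - k) k"

lemma hausdorff_weight_nonneg: "completely_monotone_seq a \<Longrightarrow> hausdorff_weight a N k \<ge> 0"
  by (simp add: hausdorff_weight_def completely_monotone_seq_iff_alt_diff)

lemma sum_hausdorff_weight: "(\<Sum>k\<le>N. hausdorff_weight a N k) = a 0"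
  using sum_choose_alt_diff[where m = N and i = 0 and j = 0 and a = a]
  by (simp add: hausdorff_weight_def)

lemma choose_times_falling_ratio:
  assumes "j \<le> k" "k \<le> N"
  shows "real (N choose k) * (\<Prod>i<j. (real k - real i) / (real N - real i)) = real (N - j choose (k - j))"
  using assms(1)
proof (induction j)
  case (Suc j)
  define n l where "n = N - Suc j" and "l = k - Suc j"
  have nl: "N - j = Suc n" "k - j = Suc l" "real N - real j = real (Suc n)" "real k - real j = real (Suc l)"
    using Suc.prems assms(2) by (auto simp: n_def l_def)
  have "real (N choose k) * (\<Prod>i<Suc j. (real k - real i) / (real N - real i))
      = real (Suc n choose Suc l) * (real (Suc l) / real (Suc n))"
    using Suc.IH Suc.prems by (simp add: nl mult.assoc[symmetric])
  also have "real (Suc n choose Suc l) * real (Suc l) = real (Suc n) * real (n choose l)"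
    by (metis Suc_times_binomial_eq mult.commute of_nat_mult)
  then have "real (Suc n choose Suc l) * (real (Suc l) / real (Suc n)) = real (n choose l)"
    by (simp add: field_simps del: binomial_Suc_Suc of_nat_Suc)
  finally show ?case by (simp add: n_def l_def)
qed simp

text \<open>
  The discrete measures reproduce the \<open>j\<close>-th term exactly once the power \<open>(k / N) ^ j\<close> is
  replaced by a ratio of falling factorials.
\<close>

lemma sum_hausdorff_weight_falling:
  assumes "j \<le> N"
  shows "(\<Sum>k\<le>N. hausdorff_weight a N k * (\<Prod>i<j. (real k - real i) / (real N - real i))) = a j"
proof -
  have "(\<Sum>k\<le>N. hausdorff_weight a N k * (\<Prod>i<j. (real k - real i) / (real N - real i)))
      = (\<Sum>k\<in>{j..N}. hausdorff_weight a N k * (\<Prod>i<j. (real k - real i) / (real N - real i)))"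
    by (rule sum.mono_neutral_right) (auto simp: prod_zero_iff)
  also have "\<dots> = (\<Sum>k\<in>{j..N}. real (N - j choose (k - j)) * alt_diff a (N - k) k)"
    using choose_times_falling_ratio
    by (intro sum.cong) (simp_all add: hausdorff_weight_def mult_ac)
  also have "\<dots> = (\<Sum>k\<le>N - j. real (N - j choose k) * alt_diff a (0 + (N - j - k)) (k + j))"
    using assms
    by (intro sum.reindex_bij_witness[of _ "\<lambda>k. k + j" "\<lambda>k. k - j"]) auto
  also have "\<dots> = a j" by (simp only: sum_choose_alt_diff alt_diff_0)
  finally show ?thesis .
qed

lemma falling_ratio_minus_power:
  assumes "k \<le> N" "2 * j < N"
  shows "\<bar>(real k / real N) ^ j - (\<Prod>i<j. (real k - real i) / (real N - real i))\<bar> \<le> real j * (real j / (real N - real j))"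
proof -
  have "norm ((\<Prod>i<j. real k / real N) - (\<Prod>i<j. (real k - real i) / (real N - real i)))
      \<le> (\<Sum>i<j. norm (real k / real N - (real k - real i) / (real N - real i)))"
    using assms by (intro norm_prod_diff) (auto simp: divide_simps)
  also have "\<dots> \<le> (\<Sum>i<j. real j / (real N - real j))"
  proof (rule sum_mono)
    fix i assume "i \<in> {..<j}"
    then have i: "i < j" "real i < real N" using assms by auto
    have "real k / real N - (real k - real i) / (real N - real i)
        = real i * (1 - real k / real N) / (real N - real i)"
      using i assms by (simp add: field_simps)
    moreover have "real i * (1 - real k / real N) \<le> real i * 1"
      by (intro mult_left_mono) auto
    moreover have "real i * (1 - real k / real N) \<ge> 0"
      using assms by (simp add: divide_le_eq)
    ultimately have "norm (real k / real N - (real k - real i) / (real N - real i)) \<le> real i / (real N - real i)"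
      using i by (simp add: divide_right_mono abs_mult)
    also have "\<dots> \<le> real j / (real N - real j)"
      using i assms by (intro frac_le) auto
    finally show "norm (real k / real N - (real k - real i) / (real N - real i)) \<le> real j / (real N - real j)" .
  qed
  finally show ?thesis by simp
qed

lemma hausdorff_moments_tendsto:
  assumes "completely_monotone_seq a"
  shows "(\<lambda>N. \<Sum>k\<le>N. hausdorff_weight a N k * (real k / real N) ^ j) \<longlonglongrightarrow> a j"
proof -
  have "\<bar>(\<Sum>k\<le>N. hausdorff_weight a N k * (real k / real N) ^ j) - a j\<bar>
      \<le> a 0 * (real j * (real j / (real N - real j)))" if N: "2 * j < N" for N
  proof -
    have "(\<Sum>k\<le>N. hausdorff_weight a N k * (real k / real N) ^ j) - a j
        = (\<Sum>k\<le>N. hausdorff_weight a N k * ((real k / real N) ^ j - (\<Prod>i<j. (real k - real i) / (real N - real i))))"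
      using sum_hausdorff_weight_falling[of j N a] N by (simp add: algebra_simps sum_subtractf)
    also have "\<bar>\<dots>\<bar> \<le> (\<Sum>k\<le>N. hausdorff_weight a N k * (real j * (real j / (real N - real j))))"
      by (rule order_trans[OF sum_abs], rule sum_mono)
        (use falling_ratio_minus_power N hausdorff_weight_nonneg[OF assms] in
          \<open>auto simp: abs_mult intro!: mult_left_mono simp del: times_divide_eq_right\<close>)
    also have "\<dots> = a 0 * (real j * (real j / (real N - real j)))"
      by (simp only: sum_distrib_right[symmetric] sum_hausdorff_weight)
    finally show ?thesis .
  qed
  then have "\<forall>\<^sub>F N in sequentially. norm ((\<Sum>k\<le>N. hausdorff_weight a N k * (real k / real N) ^ j) - a j)
      \<le> a 0 * (real j * (real j / (real N - real j)))"
    by (intro eventually_sequentiallyI[of "2 * j + 1"]) auto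
  moreover have "(\<lambda>N. a 0 * (real j * (real j / (real N - real j)))) \<longlonglongrightarrow> 0"
    by real_asymp
  ultimately have "(\<lambda>N. (\<Sum>k\<le>N. hausdorff_weight a N k * (real k / real N) ^ j) - a j) \<longlonglongrightarrow> 0"
    by (rule Lim_null_comparison)
  then show ?thesis by (simp add: LIM_zero_iff)
qed

section \<open>Holomorphic interpolation of completely monotone sequences\<close>

lemma higher_deriv_sum_exp:
  fixes c l :: "'i \<Rightarrow> complex"
  shows "(deriv ^^ n) (\<lambda>z. \<Sum>k\<in>A. c k * exp (l k * z)) = (\<lambda>z. \<Sum>k\<in>A. c k * l k ^ n * exp (l k * z))"
proof (induction n)
  case (Suc n)
  have "deriv (\<lambda>z. \<Sum>k\<in>A. c k * l k ^ n * exp (l k * z)) z = (\<Sum>k\<in>A. c k * l k ^ Suc n * exp (l k * z))" for z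
    by (rule DERIV_imp_deriv) (auto intro!: derivative_eq_intros sum.cong)
  then show ?case by (simp add: Suc.IH fun_eq_iff)
qed simp

text \<open>
  This is the form in which uniqueness is used: a bounded holomorphic function on the
  half-plane is determined by its values at the positive integers.
\<close>

lemma bounded_halfplane_eqI:
  assumes "F holomorphic_on {z. Re z > 0}" "G holomorphic_on {z. Re z > 0}"
    and F: "\<And>z. Re z > 0 \<Longrightarrow> norm (F z) \<le> A" and G: "\<And>z. Re z > 0 \<Longrightarrow> norm (G z) \<le> B"
    and eq: "\<And>k::nat. k > 0 \<Longrightarrow> F (of_nat k) = G (of_nat k)"
    and z: "Re z > 0"
  shows "F z = G z"
proof -
  have "(\<lambda>z. F z - G z) holomorphic_on {z. Re z > 0}"
    using assms(1,2) by (intro holomorphic_intros)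
  moreover have "norm (F z - G z) \<le> A + B" if "Re z > 0" for z
    using norm_triangle_ineq4[of "F z" "G z"] F[OF that] G[OF that] by linarith
  ultimately have "F z - G z = 0"
    using bounded_halfplane_zero_at_naturals[of "\<lambda>z. F z - G z" "A + B" z] eq z by simp
  then show ?thesis by simp
qed

text \<open>
  This replaces the passage from the sequence to its representing measure. The discrete
  measures of Hausdorff give the exponential sums \<open>G N z = (\<Sum>k=1..N. w N k * (k / N) powr z)\<close>,
  which are bounded by \<open>a 0\<close> on the half-plane and have derivatives of alternating sign. By
  Montel's theorem a subsequence converges locally uniformly together with all derivatives,
  and its limit inherits both properties. The node \<open>k = 0\<close> is left out of the sums: its mass
  is seen only by \<open>a 0\<close>, and for this reason the interpolation starts at \<open>k = 1\<close>.
\<close>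

lemma completely_monotone_seq_interpolation:
  assumes cm: "completely_monotone_seq a"
  shows "\<exists>g. g holomorphic_on {z. Re z > 0} \<and> (\<forall>z. Re z > 0 \<longrightarrow> norm (g z) \<le> a 0) \<and>
    (\<forall>k::nat. k > 0 \<longrightarrow> g (of_nat k) = of_real (a k)) \<and>
    (\<forall>n x. x > 0 \<longrightarrow> (- 1) ^ n * Re ((deriv ^^ n) g (of_real x)) \<ge> 0)"
proof -
  define w where "w = hausdorff_weight a"
  define l where "l N k = ln (real k / real N)" for N k :: nat
  define G where "G N z = (\<Sum>k=1..N. complex_of_real (w N k) * exp (of_real (l N k) * z))"
    for N and z :: complex
  have w: "w N k \<ge> 0" for N k
    using hausdorff_weight_nonneg[OF cm] by (simp add: w_def)
  have l: "l N k \<le> 0" if "k \<in> {1..N}" for N k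
    using that by (simp add: l_def)
  have holG: "G N holomorphic_on S" for N S
    unfolding G_def by (intro holomorphic_intros)
  have normG: "norm (G N z) \<le> a 0" if z: "Re z > 0" for N z
  proof -
    have "norm (G N z) \<le> (\<Sum>k=1..N. norm (complex_of_real (w N k) * exp (of_real (l N k) * z)))"
      unfolding G_def by (rule norm_sum)
    also have "\<dots> \<le> (\<Sum>k=1..N. w N k)"
    proof (rule sum_mono)
      fix k assume "k \<in> {1..N}"
      then have "l N k * Re z \<le> 0" using l z by (simp add: mult_nonpos_nonneg)
      then show "norm (complex_of_real (w N k) * exp (of_real (l N k) * z)) \<le> w N k"
        using w[of N k] by (simp add: norm_mult mult_left_le)
    qed
    also have "\<dots> \<le> (\<Sum>k\<le>N. w N k)"
      using w by (intro sum_mono2) auto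
    also have "\<dots> = a 0" by (simp add: w_def sum_hausdorff_weight)
    finally show ?thesis .
  qed
  have moments: "(\<lambda>N. G N (of_nat j)) \<longlonglongrightarrow> of_real (a j)" if j: "j > 0" for j :: nat
  proof -
    have "G N (of_nat j) = of_real (\<Sum>k\<le>N. w N k * (real k / real N) ^ j)" for N
    proof -
      have "exp (of_real (l N k) * of_nat j) = complex_of_real ((real k / real N) ^ j)"
        if "k \<in> {1..N}" for k
      proof -
        have "exp (of_real (l N k) * of_nat j) = complex_of_real (exp (real j * l N k))"
          by (simp add: exp_of_real[symmetric] mult.commute)
        also have "exp (real j * l N k) = (real k / real N) ^ j"
          using that by (simp add: exp_of_nat_mult l_def)
        finally show ?thesis .
      qed
      then have "G N (of_nat j) = of_real (\<Sum>k=1..N. w N k * (real k / real N) ^ j)"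
        by (simp add: G_def)
      also have "(\<Sum>k=1..N. w N k * (real k / real N) ^ j) = (\<Sum>k\<le>N. w N k * (real k / real N) ^ j)"
      proof (rule sum.mono_neutral_left)
        \<comment> \<open>The term \<open>k = 0\<close> vanishes exactly because \<open>j > 0\<close>.\<close>
        show "\<forall>k\<in>{..N} - {1..N}. w N k * (real k / real N) ^ j = 0"
        proof
          fix k assume "k \<in> {..N} - {1..N}"
          then have "k = 0" by auto
          then show "w N k * (real k / real N) ^ j = 0" using j by simp
        qed
      qed auto
      finally show ?thesis .
    qed
    then show ?thesis
      using tendsto_of_real[OF hausdorff_moments_tendsto[OF cm, of j], where 'a = complex]
      by (simp only: w_def)
  qed
  have derivG: "(- 1) ^ n * Re ((deriv ^^ n) (G N) (of_real x)) \<ge> 0" for n N and x :: real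
  proof -
    have "Re ((deriv ^^ n) (G N) (of_real x)) = (\<Sum>k=1..N. w N k * l N k ^ n * exp (l N k * x))"
      unfolding G_def higher_deriv_sum_exp
      by (simp flip: of_real_mult of_real_power add: exp_of_real)
    then have "(- 1) ^ n * Re ((deriv ^^ n) (G N) (of_real x))
        = (\<Sum>k=1..N. w N k * (- l N k) ^ n * exp (l N k * x))"
      by (simp add: sum_distrib_left power_minus[of "l N _"] mult_ac)
    also have "\<dots> \<ge> 0"
      using w l by (intro sum_nonneg mult_nonneg_nonneg zero_le_power) auto
    finally show ?thesis .
  qed
  have opn: "open {z. Re z > 0}" by (simp add: open_halfspace_Re_gt)
  obtain g r where g: "g holomorphic_on {z. Re z > 0}" and r: "strict_mono (r :: nat \<Rightarrow> nat)"
    and lim: "\<And>z. z \<in> {z. Re z > 0} \<Longrightarrow> (\<lambda>n. G (r n) z) \<longlonglongrightarrow> g z"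
    and ulim: "\<And>K. compact K \<Longrightarrow> K \<subseteq> {z. Re z > 0} \<Longrightarrow> uniform_limit K (G \<circ> r) g sequentially"
  proof (rule Montel[OF opn, of "range G" G])
    show "\<exists>B. \<forall>h\<in>range G. \<forall>z\<in>K. norm (h z) \<le> B" if "K \<subseteq> {z. Re z > 0}" for K
      using normG that by (intro exI[of _ "a 0"]) auto
  qed (use holG in auto)
  show ?thesis
  proof (intro exI[of _ g] conjI allI impI)
    show "g holomorphic_on {z. Re z > 0}" by fact
    show "norm (g z) \<le> a 0" if "Re z > 0" for z
      using normG[OF that] lim[of z] that
      by (intro Lim_norm_ubound[of sequentially "\<lambda>n. G (r n) z"]) auto
    show "g (of_nat k) = of_real (a k)" if "k > 0" for k :: nat
      using LIMSEQ_unique[OF lim[of "of_nat k"] LIMSEQ_subseq_LIMSEQ[OF moments[OF that] r, unfolded o_def]] that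
      by simp
    show "(- 1) ^ n * Re ((deriv ^^ n) g (of_real x)) \<ge> 0" if x: "x > 0" for n and x :: real
    proof -
      define A where "A = ball (complex_of_real x) (x / 2)"
      have "cball (complex_of_real x) (x / 2) \<subseteq> {z. Re z > 0}"
      proof
        fix z assume "z \<in> cball (complex_of_real x) (x / 2)"
        then have "norm (complex_of_real x - z) \<le> x / 2" by (simp add: dist_norm)
        then have "\<bar>x - Re z\<bar> \<le> x / 2"
          using abs_Re_le_cmod[of "complex_of_real x - z"] by simp
        with x have "Re z > 0" by linarith
        then show "z \<in> {z. Re z > 0}" by simp
      qed
      then have "uniform_limit (cball (complex_of_real x) (x / 2)) (G \<circ> r) g sequentially"
        by (intro ulim) auto
      then have "uniform_limit A (G \<circ> r) g sequentially"
        by (rule uniform_limit_on_subset) (auto simp: A_def)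
      then have "(\<lambda>i. (deriv ^^ n) ((G \<circ> r) i) (of_real x)) \<longlonglongrightarrow> (deriv ^^ n) g (of_real x)"
        by (rule higher_deriv_complex_uniform_limit) (use x holG in \<open>auto simp: A_def\<close>)
      then have "(\<lambda>i. (- 1) ^ n * Re ((deriv ^^ n) ((G \<circ> r) i) (of_real x)))
          \<longlonglongrightarrow> (- 1) ^ n * Re ((deriv ^^ n) g (of_real x))"
        by (intro tendsto_intros)
      then show ?thesis
        by (rule Lim_bounded2[where N = 0]) (use derivG in simp)
    qed
  qed
qed

section \<open>Completely monotone functions\<close>

text \<open>
  Iterated derivatives are taken of a function on the whole real line, but only its values
  on the positive axis are controlled. The lemma identifies them from a family of candidates
  \<open>D\<close> on that axis.
\<close>

lemma higher_deriv_eqI: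
  fixes g :: "real \<Rightarrow> real"
  assumes "\<And>x. x > 0 \<Longrightarrow> D 0 x = g x"
    and "\<And>n x. x > 0 \<Longrightarrow> (D n has_real_derivative D (Suc n) x) (at x)"
    and x: "x > 0"
  shows "(deriv ^^ n) g x = D n x" and "(deriv ^^ n) g differentiable (at x)"
proof -
  have ev: "\<forall>\<^sub>F y in nhds x. y > 0" if "x > 0" for x :: real
    using that by (intro eventually_nhds_in_open[of "{0<..}", simplified]) auto
  have eq: "(deriv ^^ n) g x = D n x" if "x > 0" for n x
    using that
  proof (induction n arbitrary: x)
    case (Suc n)
    have "deriv ((deriv ^^ n) g) x = deriv (D n) x"
      by (rule deriv_cong_ev[OF eventually_mono[OF ev[OF Suc.prems]] refl]) (rule Suc.IH)
    then show ?case using assms(2)[OF Suc.prems] by (simp add: DERIV_imp_deriv)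
  qed (simp add: assms(1))
  show "(deriv ^^ n) g x = D n x" by (rule eq[OF x])
  have "((deriv ^^ n) g has_real_derivative D (Suc n) x) (at x)"
    using assms(2)[OF x] DERIV_cong_ev[OF refl eventually_mono[OF ev[OF x]] refl] eq by blast
  then show "(deriv ^^ n) g differentiable (at x)"
    by (auto simp: real_differentiable_def)
qed

lemma has_real_derivative_Re_higher_deriv:
  assumes hol: "F holomorphic_on {z. Re z > 0}" and x: "x > 0"
  shows "((\<lambda>x. Re ((deriv ^^ n) F (of_real x))) has_real_derivative
    Re ((deriv ^^ Suc n) F (of_real x))) (at x)"
proof -
  have "(deriv ^^ n) F holomorphic_on {z. Re z > 0}"
    by (rule holomorphic_higher_deriv[OF hol]) (simp add: open_halfspace_Re_gt)
  then have "((deriv ^^ n) F has_field_derivative (deriv ^^ Suc n) F (of_real x)) (at (of_real x))"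
    using x by (auto intro!: holomorphic_derivI[of _ "{z. Re z > 0}"] simp: open_halfspace_Re_gt)
  then have "((\<lambda>x. (deriv ^^ n) F (of_real x)) has_vector_derivative (deriv ^^ Suc n) F (of_real x)) (at x)"
    by (rule has_vector_derivative_real_field)
  from bounded_linear.has_vector_derivative[OF bounded_linear_Re this] show ?thesis
    by (simp add: has_real_derivative_iff_has_vector_derivative)
qed

lemma completely_monotone_if_holomorphic_extension:
  fixes f :: "real \<Rightarrow> real"
  assumes hol: "F holomorphic_on {z. Re z > 0}"
    and eq: "\<And>x. x > 0 \<Longrightarrow> F (of_real x) = of_real (f x)"
    and sign: "\<And>n x. x > 0 \<Longrightarrow> (- 1) ^ n * Re ((deriv ^^ n) F (of_real x)) \<ge> 0"
    and lim: "(f \<longlongrightarrow> f 0) (at_right 0)"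
  shows "completely_monotone f"
proof -
  define D where "D n x = Re ((deriv ^^ n) F (of_real x))" for n and x :: real
  have D0: "D 0 x = f x" if "x > 0" for x using eq[OF that] by (simp add: D_def)
  have DS: "(D n has_real_derivative D (Suc n) x) (at x)" if "x > 0" for n x
    unfolding D_def by (rule has_real_derivative_Re_higher_deriv[OF hol that])
  have der: "(deriv ^^ n) f x = D n x" "(deriv ^^ n) f differentiable (at x)" if "x > 0" for n x
    using higher_deriv_eqI[where D = D and g = f, OF D0 DS that] by blast+
  have pos: "f x \<ge> 0" if "x > 0" for x
    using sign[OF that, of 0] eq[OF that] by simp
  have "f 0 \<ge> 0"
    by (rule tendsto_lowerbound[OF lim]) (auto simp: eventually_at_filter pos)
  then have nonneg: "f x \<ge> 0" if "x \<ge> 0" for x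
    using pos that by (cases "x = 0") auto
  have "continuous (at x within {0..}) f" if "x \<ge> 0" for x
  proof (cases "x = 0")
    case True
    then show ?thesis using lim by (simp add: continuous_within at_within_Ici_at_right)
  next
    case False
    with that der(2)[of x 0] show ?thesis
      by (simp add: differentiable_imp_continuous_within continuous_at_imp_continuous_at_within)
  qed
  then have "continuous_on {0..} f" by (simp add: continuous_on_eq_continuous_within)
  then show ?thesis
    using nonneg der sign by (simp add: completely_monotone_def D_def)
qed

lemma completely_monotone_DERIV:
  assumes "completely_monotone f" "x > 0"
  shows "((deriv ^^ n) f has_real_derivative (deriv ^^ Suc n) f x) (at x)"
  using assms by (simp add: completely_monotone_def DERIV_deriv_iff_real_differentiable)

text \<open>
  The derivatives of \<open>f\<close> are alternately decreasing and increasing, so the increments of \<open>f\<close>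
  have the same sign pattern as \<open>f\<close>. This is the step that turns signs of derivatives into
  signs of iterated differences.
\<close>

lemma completely_monotone_difference:
  assumes cm: "completely_monotone f" and h: "h > 0"
  shows "completely_monotone (\<lambda>x. f x - f (x + h))"
proof -
  have sign: "(- 1) ^ n * (deriv ^^ n) f x \<ge> 0" if "x > 0" for n x
    using cm that by (simp add: completely_monotone_def)
  have cont: "continuous_on {0..} f" using cm by (simp add: completely_monotone_def)
  define D where "D n x = (deriv ^^ n) f x - (deriv ^^ n) f (x + h)" for n x
  have DS: "(D n has_real_derivative D (Suc n) x) (at x)" if "x > 0" for n x
    unfolding D_def using that h
    by (intro DERIV_diff completely_monotone_DERIV[OF cm] DERIV_shift[THEN iffD1]) auto
  have der: "(deriv ^^ n) (\<lambda>x. f x - f (x + h)) x = D n x"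
    "(deriv ^^ n) (\<lambda>x. f x - f (x + h)) differentiable (at x)" if "x > 0" for n x
    using higher_deriv_eqI[where D = D and g = "\<lambda>x. f x - f (x + h)", OF _ DS that]
    by (simp_all add: D_def)
  have decr: "(- 1) ^ n * (deriv ^^ n) f (x + h) \<le> (- 1) ^ n * (deriv ^^ n) f x"
    if c: "continuous_on {x..x + h} ((deriv ^^ n) f)" and x: "x \<ge> 0" for n x
  proof (rule DERIV_nonpos_imp_decreasing_open[of x "x + h" "\<lambda>u. (- 1) ^ n * (deriv ^^ n) f u"])
    show "\<exists>y'. ((\<lambda>u. (- 1) ^ n * (deriv ^^ n) f u) has_real_derivative y') (at y) \<and> y' \<le> 0"
      if "x < y" "y < x + h" for y
    proof (intro exI conjI)
      show "((\<lambda>u. (- 1) ^ n * (deriv ^^ n) f u) has_real_derivative (- 1) ^ n * (deriv ^^ Suc n) f y) (at y)"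
        using x that by (intro DERIV_cmult completely_monotone_DERIV[OF cm]) auto
      show "(- 1) ^ n * (deriv ^^ Suc n) f y \<le> 0" using sign[of y "Suc n"] x that by simp
    qed
    show "continuous_on {x..x + h} (\<lambda>u. (- 1) ^ n * (deriv ^^ n) f u)"
      using c by (intro continuous_intros)
  qed (use h in auto)
  have "f x - f (x + h) \<ge> 0" if "x \<ge> 0" for x
    using decr[of x 0] that continuous_on_subset[OF cont, of "{x..x + h}"] by auto
  moreover have "(- 1) ^ n * D n x \<ge> 0" if x: "x > 0" for n x
  proof -
    have "continuous_on {x..x + h} ((deriv ^^ n) f)"
      using x by (intro DERIV_continuous_on[where D = "(deriv ^^ Suc n) f"])
        (auto intro!: has_field_derivative_at_within completely_monotone_DERIV[OF cm] simp del: funpow.simps)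
    from decr[OF this] x show ?thesis by (simp add: D_def algebra_simps)
  qed
  moreover have "continuous_on {0..} (\<lambda>x. f x - f (x + h))"
    using h by (intro continuous_intros cont continuous_on_compose2[OF cont]) auto
  ultimately show ?thesis using der by (simp add: completely_monotone_def)
qed

lemma alt_diff_Suc_left: "alt_diff a (Suc n) k = alt_diff (\<lambda>k. a k - a (Suc k)) n k"
proof (induction n arbitrary: k)
  case (Suc n)
  then show ?case using alt_diff_Suc[of a "Suc n" k] by (simp add: alt_diff_Suc)
qed (simp add: alt_diff_Suc)

lemma completely_monotone_imp_seq:
  assumes "completely_monotone f" and h: "h > 0"
  shows "completely_monotone_seq (\<lambda>k. f (real k * h))"
proof -
  have "alt_diff (\<lambda>k. f (real k * h)) n k \<ge> 0" for n k
    using assms(1)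
  proof (induction n arbitrary: f)
    case 0
    then show ?case using h by (simp add: completely_monotone_def)
  next
    case (Suc n)
    from Suc.IH[OF completely_monotone_difference[OF Suc.prems h]] show ?case
      by (simp add: alt_diff_Suc_left algebra_simps)
  qed
  then show ?thesis by (simp add: completely_monotone_seq_iff_alt_diff)
qed

text \<open>
  For each step \<open>1 / m\<close> the sampled sequence \<open>f (k / m)\<close> is interpolated by a bounded
  holomorphic function; rescaled by \<open>m\<close>, all these functions agree at the integers and hence
  coincide. The common function takes the values of \<open>f\<close> at all positive rationals, and
  therefore on the positive axis by continuity.
\<close>

lemma completely_monotone_holomorphic_extension:
  assumes cm: "completely_monotone f"
  obtains G where "G holomorphic_on {z. Re z > 0}"
    and "\<And>z. Re z > 0 \<Longrightarrow> norm (G z) \<le> f 0"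
    and "\<And>x. x > 0 \<Longrightarrow> G (of_real x) = of_real (f x)"
proof -
  obtain G where G: "G holomorphic_on {z. Re z > 0}"
    "\<And>z. Re z > 0 \<Longrightarrow> norm (G z) \<le> f 0"
    "\<And>k::nat. k > 0 \<Longrightarrow> G (of_nat k) = of_real (f (real k))"
    using completely_monotone_seq_interpolation[OF completely_monotone_imp_seq[OF cm, of 1]] by auto
  have rational: "G (of_real (real k / real m)) = of_real (f (real k / real m))"
    if k: "k > 0" and m: "m > 0" for k m :: nat
  proof -
    obtain g where g: "g holomorphic_on {z. Re z > 0}"
      "\<And>z. Re z > 0 \<Longrightarrow> norm (g z) \<le> f 0"
      "\<And>k::nat. k > 0 \<Longrightarrow> g (of_nat k) = of_real (f (real k / real m))"
      using completely_monotone_seq_interpolation[OF completely_monotone_imp_seq[OF cm, of "1 / real m"]] m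
      by auto
    have hol: "(g \<circ> (\<lambda>z. of_nat m * z)) holomorphic_on {z. Re z > 0}"
      using m by (intro holomorphic_on_compose_gen[OF _ g(1)] holomorphic_intros) auto
    have eq: "G (of_nat i) = (g \<circ> (\<lambda>z. of_nat m * z)) (of_nat i)" if "i > 0" for i :: nat
      using G(3)[OF that] g(3)[of "m * i"] m that by simp
    have "G (of_real (real k / real m)) = (g \<circ> (\<lambda>z. of_nat m * z)) (of_real (real k / real m))"
    proof (rule bounded_halfplane_eqI[OF G(1) hol G(2) _ eq, where B = "f 0"])
      show "norm ((g \<circ> (\<lambda>z. of_nat m * z)) z) \<le> f 0" if "Re z > 0" for z
        using g(2)[of "of_nat m * z"] that m by simp
      show "Re (of_real (real k / real m)) > 0" using k m by simp
    qed
    also have "\<dots> = of_real (f (real k / real m))"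
      using g(3)[OF k] m by simp
    finally show ?thesis .
  qed
  have "G (of_real x) = of_real (f x)" if x: "x > 0" for x
  proof -
    define q where "q m = real (nat \<lceil>x * real (Suc m)\<rceil>) / real (Suc m)" for m
    have nat_pos: "nat \<lceil>x * real (Suc m)\<rceil> > 0" for m
      using x by (simp del: of_nat_Suc)
    have q_eq: "G (of_real (q m)) = of_real (f (q m))" for m
      unfolding q_def by (rule rational[OF nat_pos]) simp
    have up: "real (nat \<lceil>x * real (Suc m)\<rceil>) = of_int \<lceil>x * real (Suc m)\<rceil>" for m
      using nat_pos[of m] by simp
    have bounds: "x \<le> q m" "q m \<le> x + 1 / real (Suc m)" for m
      using le_of_int_ceiling[of "x * real (Suc m)"] of_int_ceiling_le_add_one[of "x * real (Suc m)"]
      unfolding q_def up by (simp_all add: field_simps del: of_nat_Suc)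
    have "(\<lambda>m. x + 1 / real (Suc m)) \<longlonglongrightarrow> x" by real_asymp
    then have q: "q \<longlonglongrightarrow> x"
      using bounds by (intro tendsto_sandwich[of "\<lambda>_. x" q _ "\<lambda>m. x + 1 / real (Suc m)"]) auto
    have "isCont f x"
      using completely_monotone_DERIV[OF cm x, of 0] by (auto intro: DERIV_isCont)
    from tendsto_of_real[OF isCont_tendsto_compose[OF this q]]
    have f: "(\<lambda>m. complex_of_real (f (q m))) \<longlonglongrightarrow> of_real (f x)" .
    have "isCont G (of_real x)"
      using holomorphic_on_imp_continuous_on[OF G(1)] x
      by (simp add: continuous_on_eq_continuous_at open_halfspace_Re_gt)
    from isCont_tendsto_compose[OF this tendsto_of_real[OF q]]
    have "(\<lambda>m. G (of_real (q m))) \<longlonglongrightarrow> G (of_real x)" .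
    then show ?thesis unfolding q_eq using f by (rule LIMSEQ_unique)
  qed
  with G that show thesis by blast
qed

text \<open>
  If \<open>f 0\<close> could be lowered by \<open>e\<close>, then interpolating the lowered sequence would give a
  function bounded by \<open>f 0 - e\<close>. By uniqueness that function is the holomorphic extension of
  \<open>f\<close>, which contradicts the continuity of \<open>f\<close> at \<open>0\<close>.
\<close>

lemma completely_monotone_imp_minimal_seq:
  assumes cm: "completely_monotone f"
  shows "minimal_seq (\<lambda>k. f (real k))"
  unfolding minimal_seq_def
proof (intro allI impI notI)
  fix e :: real assume e: "e > 0"
    and "completely_monotone_seq ((\<lambda>k. f (real k))(0 := f (real 0) - e))"
  from completely_monotone_seq_interpolation[OF this(2)] obtain g where
    g: "g holomorphic_on {z. Re z > 0}" "\<And>z. Re z > 0 \<Longrightarrow> norm (g z) \<le> f 0 - e"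
      "\<And>k::nat. k > 0 \<Longrightarrow> g (of_nat k) = of_real (f (real k))"
    by auto
  obtain G where G: "G holomorphic_on {z. Re z > 0}"
    "\<And>z. Re z > 0 \<Longrightarrow> norm (G z) \<le> f 0" "\<And>x. x > 0 \<Longrightarrow> G (of_real x) = of_real (f x)"
    using completely_monotone_holomorphic_extension[OF cm] by blast
  have le: "f x \<le> f 0 - e" if "x > 0" for x
  proof -
    have "G (of_real x) = g (of_real x)"
    proof (rule bounded_halfplane_eqI[OF G(1) g(1) G(2) g(2)])
      show "G (of_nat k) = g (of_nat k)" if "k > 0" for k :: nat
        using G(3)[of "real k"] g(3)[OF that] that by simp
    qed (use that in simp_all)
    then have "\<bar>f x\<bar> \<le> f 0 - e"
      using g(2)[of "of_real x"] G(3)[OF that] that by (metis Re_complex_of_real norm_of_real)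
    then show ?thesis by simp
  qed
  have "continuous (at 0 within {0..}) f"
    using cm by (simp add: completely_monotone_def continuous_on_eq_continuous_within)
  then have "(f \<longlongrightarrow> f 0) (at_right 0)"
    by (simp add: continuous_within at_within_Ici_at_right)
  then have "f 0 \<le> f 0 - e"
    by (rule tendsto_upperbound) (auto simp: eventually_at_filter le)
  with e show False by simp
qed

section \<open>The characterisation\<close>

theorem theorem4:
  fixes \<Psi> :: "real \<Rightarrow> real"
  assumes "\<Psi> \<in> borel_measurable (restrict_space borel {0..})"
    and "\<And>x. x \<ge> 0 \<Longrightarrow> \<Psi> x \<ge> 0"
    and "bounded (\<Psi> ` {0..})"
  shows "completely_monotone \<Psi> \<longleftrightarrow>
     (\<exists>F. F holomorphic_on {z. Re z > 0} \<and>
          (\<forall>x>0. F (complex_of_real x) = complex_of_real (\<Psi> x)) \<and>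
          bounded (F ` {z. Re z > 0})) \<and>
     completely_monotone_seq (\<lambda>k. \<Psi> (real k)) \<and>
     minimal_seq (\<lambda>k. \<Psi> (real k))"
proof (intro iffI conjI)
  assume cm: "completely_monotone \<Psi>"
  obtain G where "G holomorphic_on {z. Re z > 0}"
    "\<And>z. Re z > 0 \<Longrightarrow> norm (G z) \<le> \<Psi> 0" "\<And>x. x > 0 \<Longrightarrow> G (of_real x) = of_real (\<Psi> x)"
    using completely_monotone_holomorphic_extension[OF cm] by blast
  then show "\<exists>F. F holomorphic_on {z. Re z > 0} \<and>
          (\<forall>x>0. F (complex_of_real x) = complex_of_real (\<Psi> x)) \<and> bounded (F ` {z. Re z > 0})"
    by (intro exI[of _ G]) (auto simp: bounded_iff)
  show "completely_monotone_seq (\<lambda>k. \<Psi> (real k))"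
    using completely_monotone_imp_seq[OF cm, of 1] by simp
  show "minimal_seq (\<lambda>k. \<Psi> (real k))"
    by (rule completely_monotone_imp_minimal_seq[OF cm])
next
  assume R: "(\<exists>F. F holomorphic_on {z. Re z > 0} \<and>
          (\<forall>x>0. F (complex_of_real x) = complex_of_real (\<Psi> x)) \<and>
          bounded (F ` {z. Re z > 0})) \<and>
     completely_monotone_seq (\<lambda>k. \<Psi> (real k)) \<and> minimal_seq (\<lambda>k. \<Psi> (real k))"
  then obtain F B where F: "F holomorphic_on {z. Re z > 0}"
    "\<And>x. x > 0 \<Longrightarrow> F (of_real x) = of_real (\<Psi> x)" "\<And>z. Re z > 0 \<Longrightarrow> norm (F z) \<le> B"
    by (auto simp: bounded_iff)
  obtain g where g: "g holomorphic_on {z. Re z > 0}"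
    "\<And>z. Re z > 0 \<Longrightarrow> norm (g z) \<le> \<Psi> 0"
    "\<And>k::nat. k > 0 \<Longrightarrow> g (of_nat k) = of_real (\<Psi> (real k))"
    "\<And>n x. x > 0 \<Longrightarrow> (- 1) ^ n * Re ((deriv ^^ n) g (of_real x)) \<ge> 0"
    using completely_monotone_seq_interpolation[of "\<lambda>k. \<Psi> (real k)"] R by auto
  have "F z = g z" if "Re z > 0" for z
  proof (rule bounded_halfplane_eqI[OF F(1) g(1) F(3) g(2)])
    show "F (of_nat k) = g (of_nat k)" if "k > 0" for k :: nat
      using F(2)[of "real k"] g(3)[OF that] that by simp
  qed (use that in simp_all)
  then have g_eq: "g (of_real x) = of_real (\<Psi> x)" if "x > 0" for x
    using F(2)[OF that] that by simp
  have le0: "\<Psi> x \<le> \<Psi> 0" if "x > 0" for x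
    using g(2)[of "of_real x"] g_eq[OF that] that by simp
  have antimono: "\<Psi> y \<le> \<Psi> x" if "0 < x" "x \<le> y" for x y
  proof -
    have "Re (g (of_real y)) \<le> Re (g (of_real x))"
    proof (rule DERIV_nonpos_imp_nonincreasing[OF that(2)])
      fix u assume "x \<le> u" "u \<le> y"
      with that have u: "u > 0" by simp
      show "\<exists>d. ((\<lambda>x. Re (g (of_real x))) has_real_derivative d) (at u) \<and> d \<le> 0"
        using has_real_derivative_Re_higher_deriv[OF g(1) u, of 0] g(4)[OF u, of 1] by auto
    qed
    then show ?thesis using that by (simp add: g_eq)
  qed
  \<comment> \<open>\<open>c\<close> is the limit of \<open>\<Psi>\<close> at \<open>0\<close> from the right. With it as value at \<open>0\<close>, \<open>\<Psi>\<close> becomes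
    completely monotone, so \<open>\<Psi> 0 - c\<close> may be taken off the first term of the sequence.
    Minimality forces this amount to be \<open>0\<close>.\<close>
  define c where "c = (SUP x\<in>{0<..}. \<Psi> x)"
  have bdd: "bdd_above (\<Psi> ` {0<..})" using le0 by (intro bdd_aboveI2[of _ _ "\<Psi> 0"]) simp
  have "c \<le> \<Psi> 0" unfolding c_def using le0 by (intro cSUP_least) auto
  define \<Phi> where "\<Phi> = \<Psi>(0 := c)"
  have lim: "(\<Psi> \<longlongrightarrow> c) (at_right 0)"
  proof (rule order_tendstoI)
    fix y assume "y < c"
    then obtain x0 where x0: "x0 > 0" "y < \<Psi> x0"
      unfolding c_def using bdd by (subst (asm) less_cSUP_iff) auto
    have "\<forall>\<^sub>F x in at_right 0. x \<in> {0<..<x0}"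
      using x0(1) by (rule eventually_at_right_real)
    then show "\<forall>\<^sub>F x in at_right 0. y < \<Psi> x"
      by (rule eventually_mono) (use x0 antimono in \<open>force intro: less_le_trans\<close>)
  next
    fix y assume "c < y"
    have "\<Psi> x < y" if "x > 0" for x
      using cSUP_upper[OF _ bdd, of x] that \<open>c < y\<close> by (simp add: c_def)
    then show "\<forall>\<^sub>F x in at_right 0. \<Psi> x < y" by (auto simp: eventually_at_filter)
  qed
  have "completely_monotone \<Phi>"
  proof (rule completely_monotone_if_holomorphic_extension[OF g(1) _ g(4)])
    have "\<forall>\<^sub>F x in at_right 0. \<Phi> x = \<Psi> x" by (auto simp: eventually_at_filter \<Phi>_def)
    then show "(\<Phi> \<longlongrightarrow> \<Phi> 0) (at_right 0)" using lim by (simp add: tendsto_cong) (simp add: \<Phi>_def)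
  qed (simp add: \<Phi>_def g_eq)
  moreover have "\<Phi> = \<Psi>"
  proof -
    have "completely_monotone_seq (\<lambda>k. \<Phi> (real k))"
      using completely_monotone_imp_seq[OF \<open>completely_monotone \<Phi>\<close>, of 1] by simp
    also have "(\<lambda>k. \<Phi> (real k)) = (\<lambda>k. \<Psi> (real k))(0 := \<Psi> (real 0) - (\<Psi> 0 - c))"
      by (auto simp: \<Phi>_def)
    finally have "\<not> \<Psi> 0 - c > 0"
      using R unfolding minimal_seq_def by blast
    with \<open>c \<le> \<Psi> 0\<close> show ?thesis by (auto simp: \<Phi>_def)
  qed
  ultimately show "completely_monotone \<Psi>" by simp
qed

end
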